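(* Let $\alpha\in\mathbb{R}$ with $-\pi/2<\alpha<\pi/2$, and let $f\in\mathcal{S}_{\alpha}$. Then the pre-Schwarzian norm of $f$ satisfies $$\|P_f\|\le 4\cos\alpha,$$ and this inequality is sharp: for each $\alpha\in(-\pi/2,\pi/2)$, the constant $4\cos\alpha$ cannot be replaced by any smaller number valid for all $f\in\mathcal{S}_{\alpha}$.
   Context: $\mathbb{D}=\{z\in\mathbb{C}:|z|<1\}$ is the open unit disk. $\mathcal{A}$ denotes the class of analytic functions $f:\mathbb{D}\to\mathbb{C}$ normalized by $f(0)=0$ and $f'(0)=1$. For $-\pi/2<\alpha<\pi/2$, the Robertson class $\mathcal{S}_{\alpha}$ is the set of $f\in\mathcal{A}$ that are locally univalent (i.e. $f'(z)\neq 0$ for all $z\in\mathbb{D}$) and satisfy $$\operatorname{Re}\left\{e^{i\alpha}\left(1+\frac{zf''(z)}{f'(z)}\right)\right\}>0\quad\text{for all } z\in\mathbb{D}.$$ For a locally univalent analytic function $f$ on $\mathbb{D}$, the pre-Schwarzian derivative and the pre-Schwarzian norm are $$P_f(z)=\frac{f''(z)}{f'(z)},\qquad \|P_f\|=\sup_{z\in\mathbb{D}}(1-|z|^2)|P_f(z)|.$$ *)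

theory Defs
  imports "HOL-Analysis.Analysis"
begin

text \<open>
  Functions on the open unit disk are represented by total functions on the complex plane.
  All notions below depend only on the values in the disk: it is open, so \<open>deriv f z\<close> and
  \<open>deriv (deriv f) z\<close> for \<open>z\<close> in the disk are determined by the restriction of \<open>f\<close> to it.
\<close>

abbreviation unit_disk :: "complex set" where
  "unit_disk \<equiv> ball 0 1"

definition normalized_analytic :: "(complex \<Rightarrow> complex) set" where
  "normalized_analytic = {f. f analytic_on unit_disk \<and> f 0 = 0 \<and> deriv f 0 = 1}"

definition pre_Schwarzian :: "(complex \<Rightarrow> complex) \<Rightarrow> complex \<Rightarrow> complex" where
  "pre_Schwarzian f z = deriv (deriv f) z / deriv f z"

text \<open>
  The supremum is taken in the extended reals, so that the norm is \<open>\<infinity>\<close> when the values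
  are unbounded; on type \<^typ>\<open>real\<close> the supremum of an unbounded set is unspecified.
\<close>

definition pre_Schwarzian_norm :: "(complex \<Rightarrow> complex) \<Rightarrow> ereal" where
  "pre_Schwarzian_norm f =
     (SUP z\<in>unit_disk. ereal ((1 - (cmod z)\<^sup>2) * cmod (pre_Schwarzian f z)))"

definition Robertson_class :: "real \<Rightarrow> (complex \<Rightarrow> complex) set" where
  "Robertson_class \<alpha> =
     {f \<in> normalized_analytic.
        (\<forall>z\<in>unit_disk. deriv f z \<noteq> 0) \<and>
        (\<forall>z\<in>unit_disk.
           Re (exp (\<i> * complex_of_real \<alpha>) *
               (1 + z * deriv (deriv f) z / deriv f z)) > 0)}"

end

theory Submission
  imports Defs "HOL-Complex_Analysis.Conformal_Mappings"
begin

text \<open>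
  For \<open>f\<close> in the Robertson class put \<open>p z = exp (\<i> * \<alpha>) * (1 + z * P z)\<close>, where \<open>P\<close> is the
  pre-Schwarzian derivative of \<open>f\<close>. This function maps the disk into the right half-plane and has
  the value \<open>p 0 = exp (\<i> * \<alpha>)\<close>, whatever \<open>f\<close> is. The Cayley transform that sends \<open>p 0\<close> to \<open>0\<close>
  carries the half-plane onto the disk, so the Schwarz lemma bounds \<open>\<bar>p z - p 0\<bar>\<close> by
  \<open>\<bar>z\<bar> * \<bar>p z + cnj (p 0)\<bar>\<close>. Here \<open>\<bar>p z - p 0\<bar> = \<bar>z * P z\<bar>\<close>, and \<open>p z + cnj (p 0)\<close> differs from
  \<open>p z - p 0\<close> by \<open>2 * Re (p 0) = 2 * cos \<alpha>\<close>; the triangle inequality therefore gives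
  \<open>(1 - \<bar>z\<bar>) * \<bar>P z\<bar> \<le> 2 * cos \<alpha>\<close> (lemma \<open>Robertson_pre_Schwarzian_bound\<close>). The remaining
  factor \<open>1 + \<bar>z\<bar>\<close> of \<open>1 - \<bar>z\<bar>\<^sup>2\<close> is less than \<open>2\<close>, which yields the bound \<open>4 * cos \<alpha>\<close>.

  Equality in the Schwarz lemma is attained by the identity, that is by
  \<open>P z = 2 * cos \<alpha> * exp (- \<i> * \<alpha>) / (1 - z)\<close>. Because
  \<open>2 * cos \<alpha> * exp (- \<i> * \<alpha>) = 1 + exp (- 2 * \<i> * \<alpha>)\<close>, two integrations give the elementary
  function \<open>Robertson_extremal\<close>. Along the radius towards \<open>1\<close> its values
  \<open>(1 - x\<^sup>2) * \<bar>P x\<bar> = 2 * cos \<alpha> * (1 + x)\<close> tend to \<open>4 * cos \<alpha>\<close>, so no smaller constant works.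
\<close>

section \<open>The Schwarz lemma for maps into the right half-plane\<close>

text \<open>
  A point of the half-plane is closer to another such point than to the reflection of that point
  in the imaginary axis; this makes the Cayley transform map the half-plane into the disk.
\<close>

lemma dist_less_dist_reflection:
  assumes "Re a > 0" "Re b > 0"
  shows "cmod (a - b) < cmod (a + cnj b)"
proof -
  have "(cmod (a + cnj b))\<^sup>2 - (cmod (a - b))\<^sup>2 = 4 * Re a * Re b"
    by (simp add: cmod_power2) (simp add: power2_eq_square algebra_simps)
  moreover have "4 * Re a * Re b > 0"
    using assms by simp
  ultimately have "(cmod (a - b))\<^sup>2 < (cmod (a + cnj b))\<^sup>2"
    by linarith
  then show ?thesis
    by (rule power2_less_imp_less) simp
qed

lemma Schwarz_Lemma_half_plane:
  assumes hol: "p holomorphic_on ball 0 1"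
    and pos: "\<And>z. cmod z < 1 \<Longrightarrow> Re (p z) > 0"
    and z: "cmod z < 1"
  shows "cmod (p z - p 0) \<le> cmod z * cmod (p z + cnj (p 0))"
proof -
  define w where "w = (\<lambda>z. (p z - p 0) / (p z + cnj (p 0)))"
  have pos0: "Re (p 0) > 0"
    using pos by simp
  have nz: "p z + cnj (p 0) \<noteq> 0" if "cmod z < 1" for z
    using dist_less_dist_reflection[OF pos[OF that] pos0] by auto
  have "cmod (w z) \<le> cmod z"
  proof (rule Schwarz_Lemma(1)[OF _ _ _ z])
    show "w holomorphic_on ball 0 1"
      unfolding w_def using hol nz by (intro holomorphic_intros) auto
    show "w 0 = 0"
      by (simp add: w_def)
    show "cmod (w z) < 1" if "cmod z < 1" for z
      using dist_less_dist_reflection[OF pos[OF that] pos0] nz[OF that]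
      by (simp add: w_def norm_divide)
  qed
  then show ?thesis
    using nz[OF z] by (simp add: w_def norm_divide field_simps)
qed

section \<open>The norm estimate\<close>

lemma Robertson_classD:
  assumes "f \<in> Robertson_class \<alpha>"
  shows "f holomorphic_on unit_disk"
    and "\<And>z. z \<in> unit_disk \<Longrightarrow> deriv f z \<noteq> 0"
    and "\<And>z. z \<in> unit_disk \<Longrightarrow>
           Re (exp (\<i> * complex_of_real \<alpha>) * (1 + z * pre_Schwarzian f z)) > 0"
  using assms
  by (auto simp: Robertson_class_def normalized_analytic_def analytic_on_open pre_Schwarzian_def)

lemma holomorphic_pre_Schwarzian:
  assumes "f \<in> Robertson_class \<alpha>"
  shows "pre_Schwarzian f holomorphic_on unit_disk"
  unfolding pre_Schwarzian_def
  using Robertson_classD[OF assms] by (auto intro!: holomorphic_intros)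

lemma Robertson_pre_Schwarzian_bound:
  assumes f: "f \<in> Robertson_class \<alpha>" and z: "z \<in> unit_disk"
  shows "(1 - cmod z) * cmod (pre_Schwarzian f z) \<le> 2 * cos \<alpha>"
proof -
  define P where "P = pre_Schwarzian f"
  define e where "e = exp (\<i> * complex_of_real \<alpha>)"
  define p where "p = (\<lambda>z. e * (1 + z * P z))"
  have holP: "P holomorphic_on unit_disk"
    unfolding P_def by (rule holomorphic_pre_Schwarzian[OF f])
  have norm_e: "cmod e = 1" and Re_e: "Re e = cos \<alpha>"
    by (simp_all add: e_def Re_exp)
  have cos_pos: "cos \<alpha> > 0"
    using Robertson_classD(3)[OF f, of 0] by (simp flip: e_def Re_e)
  have punctured: "(1 - cmod z) * cmod (P z) \<le> 2 * cos \<alpha>" if "cmod z < 1" "z \<noteq> 0" for z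
  proof -
    have diff: "cmod (p z - p 0) = cmod z * cmod (P z)"
      by (simp add: p_def algebra_simps norm_mult norm_e)
    have "cmod (p z - p 0) \<le> cmod z * cmod (p z + cnj (p 0))"
    proof (rule Schwarz_Lemma_half_plane[OF _ _ that(1)])
      show "p holomorphic_on ball 0 1"
        unfolding p_def using holP by (intro holomorphic_intros)
      show "Re (p w) > 0" if "cmod w < 1" for w
        using Robertson_classD(3)[OF f, of w] that by (simp add: p_def e_def P_def)
    qed
    also have "p z + cnj (p 0) = (p z - p 0) + of_real (2 * cos \<alpha>)"
      by (simp add: p_def complex_eq_iff Re_e)
    also have "cmod \<dots> \<le> cmod (p z - p 0) + 2 * cos \<alpha>"
      using norm_triangle_ineq[of "p z - p 0" "of_real (2 * cos \<alpha>)"] cos_pos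
      by (simp add: norm_mult)
    finally have "cmod z * cmod (P z) \<le> cmod z * (cmod z * cmod (P z) + 2 * cos \<alpha>)"
      unfolding diff by (simp add: mult_left_mono)
    then have "cmod (P z) \<le> cmod z * cmod (P z) + 2 * cos \<alpha>"
      using that(2) by simp
    then show ?thesis
      by (simp add: algebra_simps)
  qed
  show ?thesis
  proof (cases "z = 0")
    case True
    \<comment> \<open>The common factor \<open>\<bar>z\<bar>\<close> cannot be cancelled at the origin; there the bound is the limit
      of the bounds at the neighbouring points.\<close>
    have "isCont P 0"
      using holomorphic_on_imp_continuous_on[OF holP] by (simp add: continuous_on_eq_continuous_at)
    then have "((\<lambda>z. (1 - cmod z) * cmod (P z)) \<longlongrightarrow> (1 - cmod 0) * cmod (P 0)) (at 0)"
      unfolding isCont_def by (intro tendsto_intros)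
    moreover have "\<forall>\<^sub>F z in at 0. (1 - cmod z) * cmod (P z) \<le> 2 * cos \<alpha>"
      unfolding eventually_at using punctured
      by (intro exI[of _ 1]) (auto simp: dist_norm)
    ultimately have "(1 - cmod 0) * cmod (P 0) \<le> 2 * cos \<alpha>"
      by (rule tendsto_upperbound) simp
    then show ?thesis
      by (simp add: True P_def)
  next
    case False
    then show ?thesis
      using punctured[of z] z by (simp add: P_def)
  qed
qed

theorem pre_Schwarzian_norm_Robertson_le:
  assumes f: "f \<in> Robertson_class \<alpha>"
  shows "pre_Schwarzian_norm f \<le> ereal (4 * cos \<alpha>)"
  unfolding pre_Schwarzian_norm_def
proof (rule SUP_least)
  fix z :: complex assume z: "z \<in> unit_disk"
  have "(1 - (cmod z)\<^sup>2) * cmod (pre_Schwarzian f z)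
      = (1 + cmod z) * ((1 - cmod z) * cmod (pre_Schwarzian f z))"
    by (simp add: power2_eq_square algebra_simps)
  also have "\<dots> \<le> 2 * (2 * cos \<alpha>)"
    using z by (intro mult_mono Robertson_pre_Schwarzian_bound[OF f z]) auto
  finally show "ereal ((1 - (cmod z)\<^sup>2) * cmod (pre_Schwarzian f z)) \<le> ereal (4 * cos \<alpha>)"
    by simp
qed

section \<open>The extremal function\<close>

text \<open>
  For \<open>\<alpha> = 0\<close> this is \<open>z / (1 - z)\<close>, the extremal convex function; the exponent is rotated so that
  \<open>k + 1\<close> becomes the numerator of the extremal pre-Schwarzian derivative.
\<close>

definition Robertson_extremal :: "real \<Rightarrow> complex \<Rightarrow> complex" where
  "Robertson_extremal \<alpha> z =
     (let k = exp (- (2 * \<i> * complex_of_real \<alpha>)) in ((1 - z) powr (- k) - 1) / k)"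

lemma one_minus_not_nonpos_Reals:
  fixes z :: complex
  assumes "z \<in> unit_disk"
  shows "1 - z \<notin> \<real>\<^sub>\<le>\<^sub>0"
  using assms complex_Re_le_cmod[of z] by (auto simp: complex_nonpos_Reals_iff)

lemma Robertson_extremal_has_field_derivative:
  assumes "z \<in> unit_disk"
  shows "(Robertson_extremal \<alpha> has_field_derivative
           (1 - z) powr (- exp (- (2 * \<i> * complex_of_real \<alpha>)) - 1)) (at z)"
  unfolding Robertson_extremal_def Let_def
  using one_minus_not_nonpos_Reals[OF assms]
  by (auto intro!: derivative_eq_intros)

lemma deriv_Robertson_extremal:
  assumes "z \<in> unit_disk"
  shows "deriv (Robertson_extremal \<alpha>) z
           = (1 - z) powr (- exp (- (2 * \<i> * complex_of_real \<alpha>)) - 1)"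
  by (rule DERIV_imp_deriv[OF Robertson_extremal_has_field_derivative[OF assms]])

lemma deriv_Robertson_extremal_nonzero:
  assumes "z \<in> unit_disk"
  shows "deriv (Robertson_extremal \<alpha>) z \<noteq> 0"
  using one_minus_not_nonpos_Reals[OF assms] by (auto simp: deriv_Robertson_extremal[OF assms])

text \<open>
  This identity converts the exponent \<open>k\<close> of the extremal function into the factor \<open>cos \<alpha>\<close> of the
  norm bound.
\<close>

lemma one_plus_exp_minus_double:
  "1 + exp (- (2 * \<i> * complex_of_real \<alpha>))
     = 2 * complex_of_real (cos \<alpha>) * exp (- (\<i> * complex_of_real \<alpha>))"
proof -
  have "2 * complex_of_real (cos \<alpha>) = exp (\<i> * complex_of_real \<alpha>) + exp (- (\<i> * complex_of_real \<alpha>))"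
    by (simp add: cos_of_real[symmetric] cos_exp_eq)
  then show ?thesis
    by (simp add: distrib_right mult.assoc flip: exp_add)
qed

lemma pre_Schwarzian_Robertson_extremal:
  assumes z: "z \<in> unit_disk"
  shows "pre_Schwarzian (Robertson_extremal \<alpha>) z
           = 2 * complex_of_real (cos \<alpha>) * exp (- (\<i> * complex_of_real \<alpha>)) / (1 - z)"
proof -
  define k where "k = exp (- (2 * \<i> * complex_of_real \<alpha>))"
  have nonpos: "1 - z \<notin> \<real>\<^sub>\<le>\<^sub>0"
    by (rule one_minus_not_nonpos_Reals[OF z])
  then have nz: "1 - z \<noteq> 0" "(1 - z) powr (- k - 1) \<noteq> 0"
    by auto
  have "((\<lambda>z. (1 - z) powr (- k - 1)) has_field_derivative
          (k + 1) * (1 - z) powr (- k - 1 - 1)) (at z)"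
    using nonpos by (auto intro!: derivative_eq_intros simp: algebra_simps)
  then have "(deriv (Robertson_extremal \<alpha>) has_field_derivative
          (k + 1) * (1 - z) powr (- k - 1 - 1)) (at z)"
    by (rule has_field_derivative_transform_within_open[of _ _ _ unit_disk])
      (use z in \<open>auto simp: deriv_Robertson_extremal k_def\<close>)
  then have "deriv (deriv (Robertson_extremal \<alpha>)) z = (k + 1) * (1 - z) powr (- k - 1 - 1)"
    by (rule DERIV_imp_deriv)
  also have "(1 - z) powr (- k - 1 - 1) = (1 - z) powr (- k - 1) / (1 - z)"
    using nz(1) powr_diff[of "1 - z" "- k - 1" 1] by simp
  finally have "pre_Schwarzian (Robertson_extremal \<alpha>) z = (1 + k) / (1 - z)"
    using nz by (simp add: pre_Schwarzian_def deriv_Robertson_extremal[OF z] flip: k_def)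
  then show ?thesis
    by (simp add: k_def one_plus_exp_minus_double)
qed

text \<open>
  The quantity to be tested is \<open>exp (\<i> * \<alpha>) + 2 * cos \<alpha> * z / (1 - z)\<close>, with real part
  \<open>cos \<alpha> * Re ((1 + z) / (1 - z))\<close>, and \<open>(1 + z) / (1 - z)\<close> is the Cayley transform of the disk
  onto the right half-plane.
\<close>

lemma Robertson_extremal_in_Robertson_class:
  assumes cos_pos: "cos \<alpha> > 0"
  shows "Robertson_extremal \<alpha> \<in> Robertson_class \<alpha>"
proof -
  have "Re (exp (\<i> * complex_of_real \<alpha>) * (1 + z * pre_Schwarzian (Robertson_extremal \<alpha>) z)) > 0"
    if z: "z \<in> unit_disk" for z
  proof -
    have nz: "1 - z \<noteq> 0"
      using one_minus_not_nonpos_Reals[OF z] by auto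
    have "exp (\<i> * complex_of_real \<alpha>) * (1 + z * pre_Schwarzian (Robertson_extremal \<alpha>) z)
        = exp (\<i> * complex_of_real \<alpha>) + of_real (cos \<alpha>) * (2 * z / (1 - z))"
      by (simp add: pre_Schwarzian_Robertson_extremal[OF z] distrib_left exp_minus)
    also have "2 * z / (1 - z) = (1 + z) / (1 - z) - 1"
      using nz by (simp add: field_simps)
    also have "Re (exp (\<i> * complex_of_real \<alpha>) + of_real (cos \<alpha>) * ((1 + z) / (1 - z) - 1))
        = cos \<alpha> * Re ((1 + z) / (1 - z))"
      by (simp only: plus_complex.sel Re_complex_of_real Im_complex_of_real times_complex.sel
            minus_complex.sel) (simp add: Re_exp algebra_simps)
    also have "\<dots> > 0"
    proof -
      have "Re ((1 + z) / (1 - z)) = Re ((1 + z) * cnj (1 - z)) / (cmod (1 - z))\<^sup>2"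
        by (simp add: complex_div_cnj[of "1 + z"] flip: of_real_power)
      also have "Re ((1 + z) * cnj (1 - z)) = 1 - (cmod z)\<^sup>2"
        by (simp add: cmod_power2) (simp add: power2_eq_square algebra_simps)
      also have "(1 - (cmod z)\<^sup>2) / (cmod (1 - z))\<^sup>2 > 0"
        using z nz by (simp add: abs_square_less_1)
      finally show ?thesis
        using cos_pos by simp
    qed
    finally show ?thesis .
  qed
  moreover have "Robertson_extremal \<alpha> analytic_on unit_disk"
    by (auto simp: analytic_on_open holomorphic_on_open
          intro: Robertson_extremal_has_field_derivative)
  moreover have "Robertson_extremal \<alpha> 0 = 0" "deriv (Robertson_extremal \<alpha>) 0 = 1"
    by (simp_all add: deriv_Robertson_extremal) (simp add: Robertson_extremal_def)
  ultimately show ?thesis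
    by (simp add: Robertson_class_def normalized_analytic_def pre_Schwarzian_def
        deriv_Robertson_extremal_nonzero)
qed

lemma pre_Schwarzian_norm_Robertson_extremal_ge:
  assumes cos_pos: "cos \<alpha> > 0"
  shows "pre_Schwarzian_norm (Robertson_extremal \<alpha>) \<ge> ereal (4 * cos \<alpha>)"
proof -
  define N where "N = pre_Schwarzian_norm (Robertson_extremal \<alpha>)"
  have radial: "ereal (2 * cos \<alpha> * (1 + x)) \<le> N" if x: "0 \<le> x" "x < 1" for x :: real
  proof -
    have z: "complex_of_real x \<in> unit_disk"
      using x by simp
    have "cmod (1 - complex_of_real x) = 1 - x"
      using x norm_of_real[of "1 - x", where ?'a = complex] by simp
    then have "cmod (pre_Schwarzian (Robertson_extremal \<alpha>) (of_real x)) = 2 * cos \<alpha> / (1 - x)"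
      using cos_pos by (simp add: pre_Schwarzian_Robertson_extremal[OF z] norm_mult norm_divide)
    then have "(1 - (cmod (of_real x))\<^sup>2) *
        cmod (pre_Schwarzian (Robertson_extremal \<alpha>) (of_real x)) = (1 - x\<^sup>2) * (2 * cos \<alpha> / (1 - x))"
      by simp
    also have "\<dots> = 2 * cos \<alpha> * (1 + x)"
      using x by (simp add: field_simps power2_eq_square)
    finally show ?thesis
      unfolding N_def pre_Schwarzian_norm_def
      by (intro SUP_upper2[OF z]) simp
  qed
  have "((\<lambda>x. 2 * cos \<alpha> * (1 + x)) \<longlongrightarrow> 2 * cos \<alpha> * (1 + 1)) (at_left 1)"
    by (intro tendsto_intros)
  then have "((\<lambda>x. ereal (2 * cos \<alpha> * (1 + x))) \<longlongrightarrow> ereal (4 * cos \<alpha>)) (at_left 1)"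
    by simp
  moreover have "\<forall>\<^sub>F x in at_left 1. ereal (2 * cos \<alpha> * (1 + x)) \<le> N"
    using eventually_at_left_real[of 0 "1::real"]
    by (auto elim!: eventually_mono intro: radial)
  ultimately show ?thesis
    unfolding N_def by (rule tendsto_upperbound) simp
qed

section \<open>The sharp norm bound\<close>

theorem theorem2p3:
  fixes \<alpha> :: real
  assumes "- pi / 2 < \<alpha>" and "\<alpha> < pi / 2"
  shows "(\<forall>f \<in> Robertson_class \<alpha>. pre_Schwarzian_norm f \<le> ereal (4 * cos \<alpha>)) \<and>
         (\<forall>C :: real. C < 4 * cos \<alpha> \<longrightarrow>
            \<not> (\<forall>f \<in> Robertson_class \<alpha>. pre_Schwarzian_norm f \<le> ereal C))"
proof (intro conjI allI impI ballI)
  show "pre_Schwarzian_norm f \<le> ereal (4 * cos \<alpha>)" if "f \<in> Robertson_class \<alpha>" for f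
    using that by (rule pre_Schwarzian_norm_Robertson_le)
next
  fix C :: real assume C: "C < 4 * cos \<alpha>"
  have cos_pos: "cos \<alpha> > 0"
    using assms by (intro cos_gt_zero_pi) auto
  show "\<not> (\<forall>f \<in> Robertson_class \<alpha>. pre_Schwarzian_norm f \<le> ereal C)"
  proof
    assume "\<forall>f \<in> Robertson_class \<alpha>. pre_Schwarzian_norm f \<le> ereal C"
    then have "pre_Schwarzian_norm (Robertson_extremal \<alpha>) \<le> ereal C"
      using Robertson_extremal_in_Robertson_class[OF cos_pos] by blast
    with pre_Schwarzian_norm_Robertson_extremal_ge[OF cos_pos]
    have "ereal (4 * cos \<alpha>) \<le> ereal C"
      by (rule order_trans)
    with C show False
      by simp
  qed
qed

end
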